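(* There is a constant $c>0$ such that for every integer $n\ge 2$, the minimal inradius $\rho_n=\inf\{\rho(\Lambda_p): p\in\mathcal{P}_n(\overline{\mathbb{D}})\}$ satisfies $$\rho_n\ge \frac{c}{n\sqrt{\log n}}.$$
   Context: $\mathcal{P}_n(\overline{\mathbb{D}})$ is the set of monic complex polynomials of degree $n$ all of whose zeros lie in the closed unit disc $\overline{\mathbb{D}}$. For a polynomial $p$, $\Lambda_p=\{z\in\mathbb{C}:|p(z)|<1\}$. The inradius $\rho(\Omega)$ of an open set $\Omega\subset\mathbb{C}$ is the radius of the largest open disc contained in $\Omega$ (supremum of the radii of such discs). *)

theory Defs
  imports "HOL-Analysis.Analysis" "HOL-Computational_Algebra.Polynomial"
begin

definition disc_polys :: "nat \<Rightarrow> complex poly set" where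
  "disc_polys n = {p. lead_coeff p = 1 \<and> degree p = n \<and> (\<forall>z. poly p z = 0 \<longrightarrow> z \<in> cball 0 1)}"

definition lemniscate :: "complex poly \<Rightarrow> complex set" where
  "lemniscate p = {z. norm (poly p z) < 1}"

(* Valued in [0, \<infinity>], so that the supremum is meaningful for every open set:
   it is 0 for the empty set and \<infinity> if there are arbitrarily large discs. *)
definition inradius :: "complex set \<Rightarrow> ennreal" where
  "inradius \<Omega> = (SUP r \<in> {r. 0 < r \<and> (\<exists>z. ball z r \<subseteq> \<Omega>)}. ennreal r)"

definition min_inradius :: "nat \<Rightarrow> ennreal" where
  "min_inradius n = (INF p \<in> disc_polys n. inradius (lemniscate p))"

end

theory Submission
  imports Defs "HOL-Complex_Analysis.Complex_Analysis"
    "HOL-Computational_Algebra.Fundamental_Theorem_Algebra"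
begin

text \<open>
  In fact \<open>\<rho>\<^sub>n \<ge> c/n\<close>. Let \<open>a\<^sub>j\<close> be the zeros of \<open>p\<close> and \<open>u = ln |p|\<close>, and suppose that every disc of
  radius \<open>\<delta> = c/n\<close> contains a point with \<open>u \<ge> 0\<close>.
  Then \<open>-u(z) \<le> \<Sum>\<^sub>j ln (1 + \<delta>/|z - a\<^sub>j|) \<le> \<delta> \<Sum>\<^sub>j 1/|z - a\<^sub>j|\<close>, whose mean over a suitable circle \<open>|z| = s\<close> with
  \<open>s \<approx> 0.8\<close> is small. By Jensen's formula the mean of \<open>u\<close> over this circle is at most \<open>0\<close>, so the mean of
  \<open>|u|\<close> is small as well and all the zeros lie outside the circle. Inside, \<open>u\<close> is harmonic with
  \<open>u(0) \<le> 0\<close>, and since \<open>u\<close> becomes nonnegative within distance \<open>\<delta>\<close> of any point, the Schwarz formula bounds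
  the mean of \<open>|u|\<close> over the circle of radius \<open>r - h\<close> by \<open>8\<delta>/h\<close> times that over the circle of radius \<open>r\<close>.
  Taking \<open>n\<close> steps of size \<open>h = 1/(5n)\<close> makes the mean of \<open>|u|\<close> over a circle of radius at least \<open>1/2\<close> smaller
  than \<open>64\<^sup>-\<^sup>n\<close>. Then \<open>p\<close> is so close to a constant near \<open>0\<close> that its leading coefficient cannot be \<open>1\<close>.
\<close>

subsection \<open>Means over circles and the Schwarz formula\<close>

text \<open>\<open>circlepath 0 r\<close> runs once around the circle at constant speed over the
  unit interval, so the integral is already normalised. Values in a Banach space let one definition
  serve real and complex integrands.\<close>

definition circle_mean :: "real \<Rightarrow> (complex \<Rightarrow> 'a::banach) \<Rightarrow> 'a" where
  "circle_mean r F = integral {0..1} (\<lambda>t. F (circlepath 0 r t))"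

lemma norm_circlepath_0: "norm (circlepath 0 r t) = \<bar>r\<bar>"
  by (simp add: circlepath norm_mult)

lemma continuous_on_circlepath: "continuous_on A (circlepath z r)"
  unfolding circlepath by (intro continuous_intros)

lemma circle_mean_integrable:
  fixes F :: "complex \<Rightarrow> 'a::banach"
  assumes "0 \<le> r" "continuous_on (sphere 0 r) F"
  shows "(\<lambda>t. F (circlepath 0 r t)) integrable_on {0..1}"
proof -
  have "continuous_on {0..1} (F \<circ> circlepath 0 r)"
    by (rule continuous_on_compose[OF continuous_on_circlepath continuous_on_subset[OF assms(2)]])
      (use assms in \<open>auto simp: norm_circlepath_0\<close>)
  then show ?thesis
    by (intro integrable_continuous_interval) (simp add: o_def)
qed

lemma circle_mean_cong:
  assumes "0 \<le> r" "\<And>z. norm z = r \<Longrightarrow> F z = G z"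
  shows "circle_mean r F = circle_mean r G"
  using assms by (simp add: circle_mean_def norm_circlepath_0)

lemma circle_mean_const [simp]: "circle_mean r (\<lambda>z. c) = c"
  by (simp add: circle_mean_def)

lemma circle_mean_add:
  assumes "0 \<le> r" "continuous_on (sphere 0 r) F" "continuous_on (sphere 0 r) G"
  shows "circle_mean r (\<lambda>z. F z + G z) = circle_mean r F + circle_mean r G"
  using assms by (simp add: circle_mean_def integral_add circle_mean_integrable)

lemma circle_mean_diff:
  assumes "0 \<le> r" "continuous_on (sphere 0 r) F" "continuous_on (sphere 0 r) G"
  shows "circle_mean r (\<lambda>z. F z - G z) = circle_mean r F - circle_mean r G"
  using assms by (simp add: circle_mean_def integral_diff circle_mean_integrable)

lemma circle_mean_sum:
  assumes "0 \<le> r" "finite I" "\<And>i. i \<in> I \<Longrightarrow> continuous_on (sphere 0 r) (F i)"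
  shows "circle_mean r (\<lambda>z. \<Sum>i\<in>I. F i z) = (\<Sum>i\<in>I. circle_mean r (F i))"
  using assms by (simp add: circle_mean_def integral_sum circle_mean_integrable)

lemma circle_mean_cmult:
  fixes F :: "complex \<Rightarrow> 'a::{real_normed_field,banach}"
  shows "circle_mean r (\<lambda>z. c * F z) = c * circle_mean r F"
  by (cases "c = 0") (simp_all add: circle_mean_def integral_mult_right)

lemma circle_mean_cnj: "circle_mean r (\<lambda>z. cnj (F z)) = cnj (circle_mean r F)"
  by (simp add: circle_mean_def integral_cnj)

lemma circle_mean_mono:
  fixes F G :: "complex \<Rightarrow> real"
  assumes "0 \<le> r" "continuous_on (sphere 0 r) F" "continuous_on (sphere 0 r) G"
    and "\<And>z. norm z = r \<Longrightarrow> F z \<le> G z"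
  shows "circle_mean r F \<le> circle_mean r G"
  unfolding circle_mean_def
  by (rule integral_le) (use assms in \<open>auto simp: circle_mean_integrable norm_circlepath_0\<close>)

lemma circle_mean_nonneg:
  fixes F :: "complex \<Rightarrow> real"
  assumes "0 \<le> r" "continuous_on (sphere 0 r) F" "\<And>z. norm z = r \<Longrightarrow> 0 \<le> F z"
  shows "0 \<le> circle_mean r F"
  using circle_mean_mono[OF assms(1) continuous_on_const assms(2), of 0] assms(3) by simp

lemma norm_circle_mean_le:
  assumes "0 \<le> r" "continuous_on (sphere 0 r) F"
  shows "norm (circle_mean r F) \<le> circle_mean r (\<lambda>z. norm (F z))"
  unfolding circle_mean_def
  by (rule integral_norm_bound_integral)
    (use assms in \<open>auto intro!: circle_mean_integrable continuous_intros\<close>)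

lemma Re_circle_mean:
  assumes "0 \<le> r" "continuous_on (sphere 0 r) F"
  shows "Re (circle_mean r F) = circle_mean r (\<lambda>z. Re (F z))"
  unfolding circle_mean_def
  using integral_linear[OF circle_mean_integrable[OF assms] bounded_linear_Re]
  by (simp add: o_def)

lemma circle_mean_of_real:
  assumes "0 \<le> r" "continuous_on (sphere 0 r) F"
  shows "circle_mean r (\<lambda>z. complex_of_real (F z)) = of_real (circle_mean r F)"
  unfolding circle_mean_def
  using integral_linear[OF circle_mean_integrable[OF assms] bounded_linear_of_real]
  by (simp add: o_def)

text \<open>Fubini for a jointly continuous kernel. It lets a pointwise bound by a mean over an
  outer circle be averaged over an inner circle, leaving only the mean of the kernel itself to
  compute.\<close>

lemma circle_mean_swap:
  fixes G :: "complex \<Rightarrow> complex \<Rightarrow> real"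
  assumes "0 \<le> r" "0 \<le> s" "continuous_on (sphere 0 r \<times> sphere 0 s) (\<lambda>(z,w). G z w)"
  shows "circle_mean r (\<lambda>z. circle_mean s (G z)) = circle_mean s (\<lambda>w. circle_mean r (\<lambda>z. G z w))"
proof -
  have "continuous_on (cbox (0,0) (1,1)) ((\<lambda>(z,w). G z w) \<circ> (\<lambda>(t,t'). (circlepath 0 r t, circlepath 0 s t')))"
    by (rule continuous_on_compose[OF _ continuous_on_subset[OF assms(3)]])
      (use assms in \<open>auto simp: split_beta circlepath norm_mult intro!: continuous_intros\<close>)
  then have "continuous_on (cbox (0,0) (1,1)) (\<lambda>(t,t'). G (circlepath 0 r t) (circlepath 0 s t'))"
    by (simp add: o_def split_beta)
  from integral_swap_continuous[OF this] show ?thesis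
    by (simp add: circle_mean_def)
qed

lemma circle_mean_continuous_param:
  fixes G :: "complex \<Rightarrow> complex \<Rightarrow> real"
  assumes "0 \<le> s" "continuous_on (A \<times> sphere 0 s) (\<lambda>(z,w). G z w)"
  shows "continuous_on A (\<lambda>z. circle_mean s (G z))"
proof -
  have "continuous_on (A \<times> cbox 0 1) ((\<lambda>(z,w). G z w) \<circ> (\<lambda>(z,t). (z, circlepath 0 s t)))"
    by (rule continuous_on_compose[OF _ continuous_on_subset[OF assms(2)]])
      (use assms in \<open>auto simp: split_beta circlepath norm_mult intro!: continuous_intros\<close>)
  then have "continuous_on (A \<times> cbox 0 1) (\<lambda>(z,t). G z (circlepath 0 s t))"
    by (simp add: o_def split_beta)
  from integral_continuous_on_param[OF this] show ?thesis
    by (simp add: circle_mean_def)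
qed

text \<open>The variance of \<open>F\<close> is nonnegative. This trades the mean of
  \<open>1 / norm (w - z)\<close> for that of its square, which has a closed form.\<close>

lemma circle_mean_le_sqrt:
  fixes F :: "complex \<Rightarrow> real"
  assumes "0 \<le> r" "continuous_on (sphere 0 r) F"
  shows "circle_mean r F \<le> sqrt (circle_mean r (\<lambda>z. (F z)\<^sup>2))"
proof -
  define m where "m = circle_mean r F"
  have "0 \<le> circle_mean r (\<lambda>z. (F z - m)\<^sup>2)"
    using assms by (intro circle_mean_nonneg continuous_intros) auto
  also have "\<dots> = circle_mean r (\<lambda>z. (F z)\<^sup>2 + (m\<^sup>2 - 2 * m * F z))"
    by (simp add: power2_diff algebra_simps)
  also have "\<dots> = circle_mean r (\<lambda>z. (F z)\<^sup>2) + circle_mean r (\<lambda>z. m\<^sup>2 - 2 * m * F z)"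
    using assms by (intro circle_mean_add continuous_intros)
  also have "circle_mean r (\<lambda>z. m\<^sup>2 - 2 * m * F z) = m\<^sup>2 - circle_mean r (\<lambda>z. 2 * m * F z)"
    using assms by (subst circle_mean_diff) (auto intro!: continuous_intros)
  also have "circle_mean r (\<lambda>z. 2 * m * F z) = 2 * m * m"
    by (simp only: circle_mean_cmult m_def)
  finally have "m\<^sup>2 \<le> circle_mean r (\<lambda>z. (F z)\<^sup>2)"
    by (simp add: power2_eq_square)
  then show ?thesis unfolding m_def[symmetric] by (rule real_le_rsqrt)
qed

section \<open>Cauchy's formula, its conjugate version and the Schwarz formula\<close>

lemma circle_mean_Cauchy:
  assumes "F holomorphic_on cball 0 s" "norm z < s"
  shows "circle_mean s (\<lambda>w. F w * (w / (w - z))) = F z"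
proof -
  have "((\<lambda>w. F w / (w - z)) has_contour_integral (2 * of_real pi * \<i> * F z)) (circlepath 0 s)"
    using assms by (intro Cauchy_integral_circlepath_simple) auto
  then have "((\<lambda>t. F (circlepath 0 s t) / (circlepath 0 s t - z) *
      vector_derivative (circlepath 0 s) (at t within {0..1})) has_integral (2 * of_real pi * \<i> * F z)) {0..1}"
    by (simp add: has_contour_integral_def)
  \<comment> \<open>The velocity of the path is \<open>2 * pi * \<i>\<close> times the point on the
    circle; this is the source of the factor \<open>w\<close> in the kernel
    \<open>w / (w - z)\<close>.\<close>
  then have "((\<lambda>t. (2 * of_real pi * \<i>) * (F (circlepath 0 s t) * (circlepath 0 s t / (circlepath 0 s t - z))))
      has_integral (2 * of_real pi * \<i> * F z)) {0..1}"
    by (rule has_integral_eq[rotated]) (simp add: vector_derivative_circlepath01, simp add: circlepath)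
  from has_integral_mult_right[OF this, of "1 / (2 * of_real pi * \<i>)"]
  have "((\<lambda>t. F (circlepath 0 s t) * (circlepath 0 s t / (circlepath 0 s t - z))) has_integral F z) {0..1}"
    by simp
  then show ?thesis
    unfolding circle_mean_def by (rule integral_unique)
qed

lemma circle_mean_holomorphic:
  assumes "F holomorphic_on cball 0 s" "0 < s"
  shows "circle_mean s F = F 0"
proof -
  have "circle_mean s F = circle_mean s (\<lambda>w. F w * (w / (w - 0)))"
    using assms(2) by (intro circle_mean_cong) auto
  then show ?thesis using circle_mean_Cauchy[of F s 0] assms by simp
qed

text \<open>For nonzero \<open>z\<close> the only root in \<open>w\<close> is the reflection of
  \<open>z\<close> in the circle, which lies outside the closed disc.\<close>

lemma cball_reflected_ne:
  assumes "norm z < s" "norm w \<le> s"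
  shows "of_real (s\<^sup>2) - cnj z * w \<noteq> (0::complex)"
proof
  assume "of_real (s\<^sup>2) - cnj z * w = 0"
  then have "norm (cnj z * w) = s\<^sup>2"
    by (metis eq_iff_diff_eq_0 norm_of_real abs_power2)
  moreover have "norm z * norm w < s * s"
    using assms by (smt (verit, best) mult_left_mono mult_strict_right_mono norm_ge_zero)
  ultimately show False by (simp add: norm_mult power2_eq_square)
qed

text \<open>On the circle \<open>s\<^sup>2 = w * cnj w\<close>, so the Cauchy kernel is the
  conjugate of a function holomorphic on the closed disc. The mean value property then applies to
  the conjugated integrand, and only the value at 0 survives.\<close>

lemma circle_mean_cnj_Cauchy:
  assumes "F holomorphic_on cball 0 s" "norm z < s"
  shows "circle_mean s (\<lambda>w. cnj (F w) * (w / (w - z))) = cnj (F 0)"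
proof -
  have s: "0 < s" using assms(2) by (meson norm_ge_zero order_le_less_trans)
  let ?G = "\<lambda>w. F w * (of_real (s\<^sup>2) / (of_real (s\<^sup>2) - cnj z * w))"
  have "circle_mean s (\<lambda>w. cnj (F w) * (w / (w - z))) = circle_mean s (\<lambda>w. cnj (?G w))"
  proof (rule circle_mean_cong)
    fix w :: complex assume w: "norm w = s"
    have *: "of_real (s\<^sup>2) = w * cnj w" using complex_norm_square[of w] w by simp
    have "w \<noteq> 0" "w \<noteq> z" using w s assms(2) by auto
    then have "cnj (of_real (s\<^sup>2) / (of_real (s\<^sup>2) - cnj z * w)) = w / (w - z)"
      unfolding * by (simp add: field_simps)
    then show "cnj (F w) * (w / (w - z)) = cnj (?G w)" by (simp only: complex_cnj_mult)
  qed (use s in auto)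
  also have "\<dots> = cnj (circle_mean s ?G)" by (rule circle_mean_cnj)
  also have "circle_mean s ?G = ?G 0"
    by (rule circle_mean_holomorphic)
      (use assms s cball_reflected_ne[OF assms(2)] in \<open>auto intro!: holomorphic_intros\<close>)
  finally show ?thesis using s by simp
qed

text \<open>Adding Cauchy's formula and its conjugate version expresses
  \<open>F y + cnj (F 0)\<close> through \<open>Re F\<close> on the circle. Taking the difference at
  two points cancels the constant \<open>cnj (F 0)\<close>, so increments of \<open>F\<close> are
  controlled by boundary values of \<open>Re F\<close> alone.\<close>

lemma Schwarz_formula_diff:
  assumes F: "F holomorphic_on cball 0 s" and z: "norm z < s" and w: "norm w < s"
  shows "F w - F z = circle_mean s (\<lambda>\<zeta>. of_real (2 * Re (F \<zeta>)) * (\<zeta> * (w - z) / ((\<zeta> - w) * (\<zeta> - z))))"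
proof -
  have s: "0 < s" using z by (meson norm_ge_zero order_le_less_trans)
  have ne: "\<zeta> \<noteq> y" if "norm \<zeta> = s" "norm y < s" for \<zeta> y :: complex
    using that by auto
  have cF: "continuous_on (sphere 0 s) F"
    using F holomorphic_on_imp_continuous_on continuous_on_subset sphere_cball by blast
  have S: "F y + cnj (F 0) = circle_mean s (\<lambda>\<zeta>. of_real (2 * Re (F \<zeta>)) * (\<zeta> / (\<zeta> - y)))"
    if y: "norm y < s" for y
  proof -
    have "F y + cnj (F 0) = circle_mean s (\<lambda>\<zeta>. F \<zeta> * (\<zeta> / (\<zeta> - y))) + circle_mean s (\<lambda>\<zeta>. cnj (F \<zeta>) * (\<zeta> / (\<zeta> - y)))"
      by (simp only: circle_mean_Cauchy[OF F y] circle_mean_cnj_Cauchy[OF F y])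
    also have "\<dots> = circle_mean s (\<lambda>\<zeta>. F \<zeta> * (\<zeta> / (\<zeta> - y)) + cnj (F \<zeta>) * (\<zeta> / (\<zeta> - y)))"
      by (rule circle_mean_add[symmetric]) (use s cF ne[OF _ y] in \<open>auto intro!: continuous_intros\<close>)
    also have "\<dots> = circle_mean s (\<lambda>\<zeta>. of_real (2 * Re (F \<zeta>)) * (\<zeta> / (\<zeta> - y)))"
      by (simp only: distrib_right[symmetric] complex_add_cnj)
    finally show ?thesis .
  qed
  have "F w - F z = circle_mean s (\<lambda>\<zeta>. of_real (2 * Re (F \<zeta>)) * (\<zeta> / (\<zeta> - w)))
      - circle_mean s (\<lambda>\<zeta>. of_real (2 * Re (F \<zeta>)) * (\<zeta> / (\<zeta> - z)))"
    using S[OF w] S[OF z] by (metis add_diff_cancel_right)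
  also have "\<dots> = circle_mean s (\<lambda>\<zeta>. of_real (2 * Re (F \<zeta>)) * (\<zeta> / (\<zeta> - w)) - of_real (2 * Re (F \<zeta>)) * (\<zeta> / (\<zeta> - z)))"
    by (rule circle_mean_diff[symmetric]) (use s cF ne[OF _ w] ne[OF _ z] in \<open>auto intro!: continuous_intros\<close>)
  also have "\<dots> = circle_mean s (\<lambda>\<zeta>. of_real (2 * Re (F \<zeta>)) * (\<zeta> * (w - z) / ((\<zeta> - w) * (\<zeta> - z))))"
  proof (rule circle_mean_cong)
    fix \<zeta> :: complex assume "norm \<zeta> = s"
    then have "\<zeta> - w \<noteq> 0" "\<zeta> - z \<noteq> 0" using ne w z by auto
    then have "\<zeta> / (\<zeta> - w) - \<zeta> / (\<zeta> - z) = \<zeta> * (w - z) / ((\<zeta> - w) * (\<zeta> - z))"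
      by (simp add: diff_frac_eq) (simp add: algebra_simps)
    then show "of_real (2 * Re (F \<zeta>)) * (\<zeta> / (\<zeta> - w)) - of_real (2 * Re (F \<zeta>)) * (\<zeta> / (\<zeta> - z))
      = of_real (2 * Re (F \<zeta>)) * (\<zeta> * (w - z) / ((\<zeta> - w) * (\<zeta> - z)))"
      by (metis right_diff_distrib)
  qed (use s in auto)
  finally show ?thesis .
qed

subsection \<open>Kernels and logarithms averaged over circles\<close>

text \<open>The normalisation of the Poisson kernel, inside and outside. Since \<open>cnj w\<close>
  equals \<open>s\<^sup>2 / w\<close> on the circle, the integrand is rational in \<open>w\<close>
  and Cauchy's formula evaluates it at its one pole in the disc.\<close>

lemma circle_mean_inverse_square:
  assumes s: "0 < s" and z: "norm z \<noteq> s"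
  shows "circle_mean s (\<lambda>w. 1 / (norm (w - z))\<^sup>2) = 1 / \<bar>s\<^sup>2 - (norm z)\<^sup>2\<bar>"
proof -
  have ne: "w \<noteq> z" if "norm w = s" for w using that z by auto
  have sq: "w * cnj w = of_real (s\<^sup>2)" if "norm w = s" for w :: complex
    using complex_norm_square[of w] that by simp
  have inv: "of_real (1 / (norm (w - z))\<^sup>2) = 1 / ((w - z) * (cnj w - cnj z))" for w
    using complex_norm_square[of "w - z"] by simp
  have zz: "z * cnj z = of_real ((norm z)\<^sup>2)"
    using complex_norm_square[of z] by simp
  have "of_real (circle_mean s (\<lambda>w. 1 / (norm (w - z))\<^sup>2))
      = circle_mean s (\<lambda>w. complex_of_real (1 / (norm (w - z))\<^sup>2))"
    by (rule circle_mean_of_real[symmetric]) (use s ne in \<open>auto intro!: continuous_intros\<close>)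
  also have "\<dots> = of_real (1 / \<bar>s\<^sup>2 - (norm z)\<^sup>2\<bar>)"
  proof (cases "norm z < s")
    case True
    have "circle_mean s (\<lambda>w. complex_of_real (1 / (norm (w - z))\<^sup>2))
        = circle_mean s (\<lambda>w. (1 / (of_real (s\<^sup>2) - cnj z * w)) * (w / (w - z)))"
    proof (rule circle_mean_cong)
      fix w :: complex assume w: "norm w = s"
      have "w \<noteq> 0" using w s by auto
      then show "complex_of_real (1 / (norm (w - z))\<^sup>2) = (1 / (of_real (s\<^sup>2) - cnj z * w)) * (w / (w - z))"
        unfolding inv sq[OF w, symmetric] using ne[OF w]
        by (simp add: divide_simps) (simp add: algebra_simps)
    qed (use s in auto)
    also have "\<dots> = 1 / (of_real (s\<^sup>2) - cnj z * z)"
      by (rule circle_mean_Cauchy)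
        (use True cball_reflected_ne[OF True] in \<open>auto intro!: holomorphic_intros\<close>)
    also have "\<dots> = of_real (1 / (s\<^sup>2 - (norm z)\<^sup>2))"
      using zz by (simp add: mult.commute)
    also have "s\<^sup>2 - (norm z)\<^sup>2 = \<bar>s\<^sup>2 - (norm z)\<^sup>2\<bar>"
      using True power_strict_mono[of "norm z" s 2] by simp
    finally show ?thesis .
  next
    case False
    then have gt: "norm z > s" using z by simp
    then have z0: "z \<noteq> 0" using s by auto
    \<comment> \<open>With \<open>z\<close> outside, the pole inside the disc is the reflection of
      \<open>z\<close> in the circle.\<close>
    define b where "b = of_real (s\<^sup>2) / cnj z"
    have b: "norm b < s"
      using gt s z0 by (simp add: b_def norm_divide norm_mult power2_eq_square divide_simps)
    have "circle_mean s (\<lambda>w. complex_of_real (1 / (norm (w - z))\<^sup>2))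
        = circle_mean s (\<lambda>w. (1 / (cnj z * (z - w))) * (w / (w - b)))"
    proof (rule circle_mean_cong)
      fix w :: complex assume w: "norm w = s"
      have "w \<noteq> 0" "w \<noteq> b" using w s b by auto
      moreover have "cnj w \<noteq> cnj z" using ne[OF w] by simp
      moreover have "w - b = w * (cnj z - cnj w) / cnj z"
        using z0 sq[OF w] by (simp add: b_def field_simps)
      ultimately show "complex_of_real (1 / (norm (w - z))\<^sup>2) = (1 / (cnj z * (z - w))) * (w / (w - b))"
        unfolding inv using ne[OF w] z0
        by (simp add: divide_simps) (simp add: algebra_simps)
    qed (use s in auto)
    also have "\<dots> = 1 / (cnj z * (z - b))"
      by (rule circle_mean_Cauchy) (use b gt z0 in \<open>auto intro!: holomorphic_intros\<close>)
    also have "\<dots> = of_real (1 / ((norm z)\<^sup>2 - s\<^sup>2))"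
      using zz z0 by (simp add: b_def algebra_simps)
    also have "(norm z)\<^sup>2 - s\<^sup>2 = \<bar>s\<^sup>2 - (norm z)\<^sup>2\<bar>"
      using gt s power_strict_mono[of s "norm z" 2] by simp
    finally show ?thesis .
  qed
  finally show ?thesis using of_real_eq_iff by blast
qed

lemma circle_mean_inverse_le:
  assumes "0 < s" "norm z \<noteq> s"
  shows "circle_mean s (\<lambda>w. 1 / norm (w - z)) \<le> 1 / sqrt \<bar>s\<^sup>2 - (norm z)\<^sup>2\<bar>"
proof -
  have "circle_mean s (\<lambda>w. 1 / norm (w - z)) \<le> sqrt (circle_mean s (\<lambda>w. (1 / norm (w - z))\<^sup>2))"
    by (rule circle_mean_le_sqrt) (use assms in \<open>auto intro!: continuous_intros\<close>)
  then show ?thesis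
    using circle_mean_inverse_square[OF assms] by (simp add: power_divide real_sqrt_divide)
qed

lemma Re_one_minus_pos: "norm w < 1 \<Longrightarrow> 0 < Re (1 - w)"
  using complex_Re_le_cmod[of w] by simp

text \<open>Jensen's formula for a single zero. On the circle, \<open>norm (w - a)\<close> is the
  constant \<open>max s (norm a)\<close> times \<open>norm (1 - c * w)\<close>, and the logarithm of
  the latter is harmonic on the closed disc with value 0 at the centre.\<close>

lemma circle_mean_ln_norm:
  assumes s: "0 < s" and a: "norm a \<noteq> s"
  shows "circle_mean s (\<lambda>w. ln (norm (w - a))) = ln (max s (norm a))"
proof -
  \<comment> \<open>A zero inside the disc is reflected to the outside; in both cases
    \<open>norm (c * w) < 1\<close> on the closed disc, so the principal branch \<open>Ln\<close> is
    holomorphic there.\<close>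
  define c where "c = (if norm a < s then cnj a / of_real (s\<^sup>2) else 1 / a)"
  have c: "norm (c * w) < 1" if "norm w \<le> s" for w
  proof (cases "norm a < s")
    case True
    have "norm a * norm w < s * s"
      using that True s by (smt (verit, best) mult_left_mono mult_strict_right_mono norm_ge_zero)
    then show ?thesis using True s by (simp add: c_def norm_mult norm_divide power2_eq_square)
  next
    case False
    then have "norm w < norm a" using a that by simp
    then show ?thesis using False s by (simp add: c_def norm_divide divide_less_eq)
  qed
  have pos: "1 - c * w \<notin> \<real>\<^sub>\<le>\<^sub>0" if "norm w \<le> s" for w
    using Re_one_minus_pos[OF c[OF that]] by (auto simp: complex_nonpos_Reals_iff)
  have hol: "(\<lambda>w. Ln (1 - c * w)) holomorphic_on cball 0 s"
    using pos by (auto intro!: holomorphic_intros)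
  have "0 = Re (circle_mean s (\<lambda>w. Ln (1 - c * w)))"
    using circle_mean_holomorphic[OF hol s] by simp
  also have "\<dots> = circle_mean s (\<lambda>w. Re (Ln (1 - c * w)))"
    using s continuous_on_subset[OF holomorphic_on_imp_continuous_on[OF hol] sphere_cball]
    by (intro Re_circle_mean) auto
  also have "\<dots> = circle_mean s (\<lambda>w. ln (norm (w - a)) - ln (max s (norm a)))"
  proof (rule circle_mean_cong)
    fix w :: complex assume w: "norm w = s"
    have sq: "w * cnj w = of_real (s\<^sup>2)"
      using complex_norm_square[of w] w by simp
    have wa: "norm (w - a) > 0" using w a by auto
    have "norm (1 - c * w) = norm (w - a) / max s (norm a)"
    proof (cases "norm a < s")
      case True
      have "1 - c * w = w * cnj (w - a) / of_real (s\<^sup>2)"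
        using True s sq by (simp add: c_def field_simps)
      then have "norm (1 - c * w) = norm w * norm (w - a) / s\<^sup>2"
        by (simp only: norm_divide norm_mult complex_mod_cnj norm_of_real abs_power2)
      then show ?thesis using True w s by (simp add: power2_eq_square)
    next
      case False
      then have "a \<noteq> 0" using s by auto
      then have "1 - c * w = (a - w) / a" using False by (simp add: c_def field_simps)
      then show ?thesis using False a by (simp add: norm_divide norm_minus_commute)
    qed
    moreover have "1 - c * w \<noteq> 0" using pos[of w] w by auto
    ultimately show "Re (Ln (1 - c * w)) = ln (norm (w - a)) - ln (max s (norm a))"
      using wa s by (simp add: ln_div)
  qed (use s in auto)
  also have "\<dots> = circle_mean s (\<lambda>w. ln (norm (w - a))) - ln (max s (norm a))"
    by (subst circle_mean_diff) (use s a in \<open>auto intro!: continuous_intros\<close>)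
  finally show ?thesis by simp
qed

text \<open>Each summand has integral below 4 over an interval of length \<open>1/4\<close>, so the
  sum has average below \<open>16 * n\<close> and some \<open>x\<close> does no worse. Here
  \<open>x\<close> is the square of the radius to be chosen and \<open>b j\<close> the squared
  modulus of a zero.\<close>

lemma exists_sum_inverse_sqrt_le:
  fixes b :: "nat \<Rightarrow> real"
  assumes b: "\<And>j. j < n \<Longrightarrow> 0 \<le> b j \<and> b j \<le> 1" and n: "0 < n"
  obtains x where "1/2 < x" "x < 3/4" "\<And>j. j < n \<Longrightarrow> b j \<noteq> x"
    "(\<Sum>j<n. 1 / sqrt \<bar>x - b j\<bar>) \<le> 16 * real n"
proof -
  \<comment> \<open>The finitely many excluded values: the endpoints, and the radii on which a zero
    would lie.\<close>
  define S where "S = {1/2, 3/4} \<union> b ` {..<n}"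
  have "\<exists>x\<in>{1/2..3/4} - S. (\<Sum>j<n. 1 / sqrt \<bar>x - b j\<bar>) \<le> 16 * real n"
  proof (rule ccontr)
    assume neg: "\<not> ?thesis"
    \<comment> \<open>\<open>sqrt\<close> is an odd function on all reals, so
      \<open>2 * sqrt (x - b j)\<close> is continuous and is an antiderivative on both sides of the
      singularity.\<close>
    have int1: "((\<lambda>x. 1 / sqrt \<bar>x - b j\<bar>) has_integral (2 * sqrt (3/4 - b j) - 2 * sqrt (1/2 - b j))) {1/2..3/4}" for j
    proof (rule fundamental_theorem_of_calculus_interior_strong[of "{b j}"])
      fix x assume "x \<in> {1 / 2<..<3 / 4} - {b j}"
      then have x: "x - b j \<noteq> 0" by simp
      have "((\<lambda>x. 2 * sqrt (x - b j)) has_real_derivative 1 / sqrt \<bar>x - b j\<bar>) (at x)"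
      proof -
        have "(sqrt has_real_derivative 1 / (2 * sqrt \<bar>x - b j\<bar>)) (at (x - b j))"
          using x real_sqrt_minus[of "x - b j"]
          by (intro DERIV_real_sqrt_generic) (auto simp: field_simps)
        moreover have "((\<lambda>x. x - b j) has_real_derivative 1) (at x)"
          by (auto intro!: derivative_eq_intros)
        ultimately
        have "((\<lambda>x. sqrt (x - b j)) has_real_derivative 1 / (2 * sqrt \<bar>x - b j\<bar>)) (at x)"
          using DERIV_chain2[where f = sqrt and g = "\<lambda>x. x - b j"] by fastforce
        from DERIV_cmult[OF this, of 2] show ?thesis by simp
      qed
      then show "((\<lambda>x. 2 * sqrt (x - b j)) has_vector_derivative 1 / sqrt \<bar>x - b j\<bar>) (at x)"
        by (simp add: has_real_derivative_iff_has_vector_derivative)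
    qed (auto intro!: continuous_intros)
    have lt: "2 * sqrt (3/4 - b j) - 2 * sqrt (1/2 - b j) < 4" if "j < n" for j
    proof -
      have "sqrt (3/4 - b j) < 1" using b[OF that] by (simp add: real_sqrt_lt_1_iff)
      moreover have "sqrt (1/2 - b j) \<ge> - 1"
        using b[OF that] real_sqrt_le_mono[of "-1" "1/2 - b j"] by (simp add: real_sqrt_minus)
      ultimately show ?thesis by linarith
    qed
    have sum: "((\<lambda>x. \<Sum>j<n. 1 / sqrt \<bar>x - b j\<bar>) has_integral (\<Sum>j<n. 2 * sqrt (3/4 - b j) - 2 * sqrt (1/2 - b j))) {1/2..3/4}"
      by (rule has_integral_sum) (auto intro: int1)
    \<comment> \<open>Overwriting the integrand on the finite set \<open>S\<close> keeps the
      integral and makes the negated claim a lower bound at every point.\<close>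
    have upper: "((\<lambda>x. if x \<in> S then 16 * real n else (\<Sum>j<n. 1 / sqrt \<bar>x - b j\<bar>)) has_integral
        (\<Sum>j<n. 2 * sqrt (3/4 - b j) - 2 * sqrt (1/2 - b j))) {1/2..3/4}"
      by (rule has_integral_spike_finite[OF _ _ sum, of S]) (auto simp: S_def)
    have lower: "((\<lambda>x. 16 * real n) has_integral 4 * real n) {1/2..3/4::real}"
      using has_integral_const_real[of "16 * real n" "1/2" "3/4"] by simp
    have "4 * real n \<le> (\<Sum>j<n. 2 * sqrt (3/4 - b j) - 2 * sqrt (1/2 - b j))"
      by (rule has_integral_le[OF lower upper]) (use neg in \<open>fastforce simp: not_le intro: less_imp_le\<close>)
    also have "\<dots> < (\<Sum>j<n. 4)"
      by (rule sum_strict_mono) (use lt n in auto)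
    finally show False by simp
  qed
  then show thesis using that by (force simp: S_def)
qed

subsection \<open>Inside the zero-free disc\<close>

text \<open>Where \<open>Re (F z)\<close> is negative, a point \<open>w\<close> within
  \<open>\<delta>\<close> has \<open>Re (F w)\<close> nonnegative, so the Schwarz formula bounds the
  negative part by \<open>\<delta>\<close> times an integral of \<open>\<bar>Re F\<bar>\<close> over
  the outer circle. The mean of \<open>Re F\<close> is \<open>Re (F 0)\<close>, which is at most 0,
  so the negative part controls the whole mean.\<close>

lemma circle_mean_abs_Re_growth:
  assumes F: "F holomorphic_on cball 0 s" and r: "0 < r" and rs: "2 * \<delta> \<le> s - r" and \<delta>: "0 < \<delta>"
    and F0: "Re (F 0) \<le> 0"
    and hit: "\<And>z. norm z = r \<Longrightarrow> \<exists>w\<in>ball z \<delta>. 0 \<le> Re (F w)"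
  shows "circle_mean r (\<lambda>z. \<bar>Re (F z)\<bar>) \<le> 8 * \<delta> / (s - r) * circle_mean s (\<lambda>z. \<bar>Re (F z)\<bar>)"
proof -
  have s: "0 < s" "r < s" using r rs \<delta> by auto
  have cF: "continuous_on (cball 0 s) F"
    using F by (rule holomorphic_on_imp_continuous_on)
  have cs: "continuous_on (sphere 0 s) F" and cr: "continuous_on (sphere 0 r) F"
    by (rule continuous_on_subset[OF cF]; use s in auto)+
  have Fr: "F holomorphic_on cball 0 r"
    by (rule holomorphic_on_subset[OF F]) (use s in auto)
  have ne: "\<zeta> \<noteq> z" if "norm \<zeta> = s" "norm z < s" for \<zeta> z :: complex
    using that by auto
  \<comment> \<open>A majorant of the Schwarz kernel that no longer involves \<open>w\<close>. Of
    the factor 4, one 2 comes from the formula and one from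
    \<open>norm (\<zeta> - w) \<ge> norm (\<zeta> - z) / 2\<close>.\<close>
  define K where "K = (\<lambda>z \<zeta>. 4 * s * \<delta> * (\<bar>Re (F \<zeta>)\<bar> * (1 / (norm (\<zeta> - z))\<^sup>2)))"
  have K0: "0 \<le> K z \<zeta>" for z \<zeta>
    using s \<delta> by (simp add: K_def)
  have cK2: "continuous_on (sphere 0 r \<times> sphere 0 s) (\<lambda>(z, \<zeta>). K z \<zeta>)"
    unfolding K_def split_beta
    using s by (intro continuous_intros continuous_on_compose2[OF cs continuous_on_snd]) (auto intro!: continuous_intros)
  have cK: "continuous_on (sphere 0 s) (K z)" if "norm z = r" for z
    unfolding K_def using cs ne that s by (auto intro!: continuous_intros)
  have pointwise: "- Re (F z) \<le> circle_mean s (K z)" if z: "norm z = r" and neg: "Re (F z) < 0" for z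
  proof -
    obtain w where w: "norm (w - z) < \<delta>" "0 \<le> Re (F w)"
      using hit[OF z] by (auto simp: dist_norm norm_minus_commute)
    have zs: "norm z < s" using z s by simp
    have ws: "norm w < s" using norm_triangle_sub[of w z] w(1) z rs \<delta> by linarith
    let ?H = "\<lambda>\<zeta>. of_real (2 * Re (F \<zeta>)) * (\<zeta> * (w - z) / ((\<zeta> - w) * (\<zeta> - z)))"
    have cH: "continuous_on (sphere 0 s) ?H"
      using cs ne zs ws by (auto intro!: continuous_intros)
    have "- Re (F z) \<le> norm (F w - F z)"
      using w(2) complex_Re_le_cmod[of "F w - F z"] by simp
    also have "\<dots> = norm (circle_mean s ?H)"
      by (simp only: Schwarz_formula_diff[OF F zs ws])
    also have "\<dots> \<le> circle_mean s (\<lambda>\<zeta>. norm (?H \<zeta>))"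
      using s cH by (intro norm_circle_mean_le) auto
    also have "\<dots> \<le> circle_mean s (K z)"
    proof (rule circle_mean_mono)
      fix \<zeta> :: complex assume \<zeta>: "norm \<zeta> = s"
      have d: "2 * \<delta> \<le> norm (\<zeta> - z)"
        using norm_triangle_ineq2[of \<zeta> z] \<zeta> z rs by linarith
      moreover have "norm (\<zeta> - z) \<le> norm (\<zeta> - w) + norm (w - z)"
        using norm_triangle_ineq[of "\<zeta> - w" "w - z"] by simp
      ultimately have d2: "norm (\<zeta> - z) / 2 \<le> norm (\<zeta> - w)" using w(1) by linarith
      have pos: "0 < norm (\<zeta> - z)" using d \<delta> by linarith
      have "norm (w - z) / (norm (\<zeta> - w) * norm (\<zeta> - z)) \<le> \<delta> / (norm (\<zeta> - z) / 2 * norm (\<zeta> - z))"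
        using d2 pos w(1) \<delta> by (intro frac_le mult_right_mono) auto
      also have "\<dots> = 2 * \<delta> * (1 / (norm (\<zeta> - z))\<^sup>2)"
        using pos by (simp add: power2_eq_square)
      finally have "2 * \<bar>Re (F \<zeta>)\<bar> * s * (norm (w - z) / (norm (\<zeta> - w) * norm (\<zeta> - z)))
          \<le> 2 * \<bar>Re (F \<zeta>)\<bar> * s * (2 * \<delta> * (1 / (norm (\<zeta> - z))\<^sup>2))"
        using s by (intro mult_left_mono) auto
      then show "norm (?H \<zeta>) \<le> K z \<zeta>"
        by (simp add: K_def norm_mult norm_divide \<zeta> mult_ac)
    qed (use s cH cK[OF z] in \<open>auto intro!: continuous_intros\<close>)
    finally show ?thesis .
  qed
  have Kmean0: "0 \<le> circle_mean s (K z)" if "norm z = r" for z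
    using s cK[OF that] K0 by (intro circle_mean_nonneg) auto
  have cKm: "continuous_on (sphere 0 r) (\<lambda>z. circle_mean s (K z))"
    using s cK2 by (intro circle_mean_continuous_param) auto
  \<comment> \<open>An absolute value is the number itself plus twice its negative part.\<close>
  have "circle_mean r (\<lambda>z. \<bar>Re (F z)\<bar>) \<le> circle_mean r (\<lambda>z. Re (F z) + 2 * circle_mean s (K z))"
  proof (rule circle_mean_mono)
    fix z :: complex assume "norm z = r"
    then show "\<bar>Re (F z)\<bar> \<le> Re (F z) + 2 * circle_mean s (K z)"
      using pointwise[of z] Kmean0[of z] by (cases "Re (F z) < 0") auto
  qed (use r cr cKm in \<open>auto intro!: continuous_intros\<close>)
  also have "\<dots> = circle_mean r (\<lambda>z. Re (F z)) + 2 * circle_mean r (\<lambda>z. circle_mean s (K z))"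
    using r cr cKm by (subst circle_mean_add) (auto intro!: continuous_intros simp: circle_mean_cmult)
  also have "circle_mean r (\<lambda>z. Re (F z)) = Re (F 0)"
    using Re_circle_mean[of r F] circle_mean_holomorphic[OF Fr r] r cr by simp
  also have "circle_mean r (\<lambda>z. circle_mean s (K z)) = circle_mean s (\<lambda>\<zeta>. circle_mean r (\<lambda>z. K z \<zeta>))"
    using r s cK2 by (intro circle_mean_swap) auto
  also have "\<dots> = circle_mean s (\<lambda>\<zeta>. 4 * s * \<delta> / (s\<^sup>2 - r\<^sup>2) * \<bar>Re (F \<zeta>)\<bar>)"
  proof (rule circle_mean_cong)
    fix \<zeta> :: complex assume \<zeta>: "norm \<zeta> = s"
    have "circle_mean r (\<lambda>z. 1 / (norm (\<zeta> - z))\<^sup>2) = 1 / \<bar>r\<^sup>2 - s\<^sup>2\<bar>"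
      using circle_mean_inverse_square[of r \<zeta>] r s \<zeta> by (simp add: norm_minus_commute)
    also have "\<bar>r\<^sup>2 - s\<^sup>2\<bar> = s\<^sup>2 - r\<^sup>2"
      using power_strict_mono[of r s 2] r s by simp
    finally show "circle_mean r (\<lambda>z. K z \<zeta>) = 4 * s * \<delta> / (s\<^sup>2 - r\<^sup>2) * \<bar>Re (F \<zeta>)\<bar>"
      by (simp only: K_def circle_mean_cmult) simp
  qed (use s in auto)
  also have "\<dots> = 4 * s * \<delta> / (s\<^sup>2 - r\<^sup>2) * circle_mean s (\<lambda>\<zeta>. \<bar>Re (F \<zeta>)\<bar>)"
    by (rule circle_mean_cmult)
  also have "Re (F 0) + 2 * (4 * s * \<delta> / (s\<^sup>2 - r\<^sup>2) * circle_mean s (\<lambda>\<zeta>. \<bar>Re (F \<zeta>)\<bar>))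
      \<le> 8 * s * \<delta> / (s\<^sup>2 - r\<^sup>2) * circle_mean s (\<lambda>\<zeta>. \<bar>Re (F \<zeta>)\<bar>)"
    using F0 by simp
  also have "\<dots> \<le> 8 * \<delta> / (s - r) * circle_mean s (\<lambda>\<zeta>. \<bar>Re (F \<zeta>)\<bar>)"
  proof (rule mult_right_mono)
    have "8 * s * \<delta> / (s\<^sup>2 - r\<^sup>2) = 8 * \<delta> / (s - r) * (s / (s + r))"
      by (simp add: power2_eq_square square_diff_square_factored mult_ac)
    also have "\<dots> \<le> 8 * \<delta> / (s - r) * 1"
      using r s \<delta> by (intro mult_left_mono) auto
    finally show "8 * s * \<delta> / (s\<^sup>2 - r\<^sup>2) \<le> 8 * \<delta> / (s - r)" by simp
    show "0 \<le> circle_mean s (\<lambda>\<zeta>. \<bar>Re (F \<zeta>)\<bar>)"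
      using s cs by (intro circle_mean_nonneg continuous_intros) auto
  qed
  finally show ?thesis .
qed

text \<open>Iterates the one-step estimate over \<open>k\<close> circles, each of radius smaller by
  \<open>h\<close> than the one before. This gives geometric decay once
  \<open>8 * \<delta> < h\<close>.\<close>

lemma circle_mean_abs_Re_decay:
  assumes F: "F holomorphic_on cball 0 s" and h: "2 * \<delta> \<le> h" and \<delta>: "0 < \<delta>"
    and F0: "Re (F 0) \<le> 0"
    and hit: "\<And>z. norm z \<le> s - h \<Longrightarrow> \<exists>w\<in>ball z \<delta>. 0 \<le> Re (F w)"
    and k: "real k * h < s"
  shows "circle_mean (s - real k * h) (\<lambda>z. \<bar>Re (F z)\<bar>) \<le> (8 * \<delta> / h) ^ k * circle_mean s (\<lambda>z. \<bar>Re (F z)\<bar>)"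
  using k
proof (induction k)
  case 0
  then show ?case by simp
next
  case (Suc k)
  define s' where "s' = s - real k * h"
  have hpos: "0 < h" using h \<delta> by simp
  have s': "s - real (Suc k) * h = s' - h" by (simp add: s'_def algebra_simps)
  have "0 \<le> real k * h" using hpos by simp
  then have s's: "s' \<le> s" unfolding s'_def by linarith
  have "circle_mean (s' - h) (\<lambda>z. \<bar>Re (F z)\<bar>) \<le> 8 * \<delta> / (s' - (s' - h)) * circle_mean s' (\<lambda>z. \<bar>Re (F z)\<bar>)"
  proof (rule circle_mean_abs_Re_growth)
    show "F holomorphic_on cball 0 s'"
      by (rule holomorphic_on_subset[OF F]) (use s's in auto)
    show "0 < s' - h" using Suc.prems s' by simp
    show "\<exists>w\<in>ball z \<delta>. 0 \<le> Re (F w)" if "norm z = s' - h" for z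
      using s's that by (intro hit) simp
  qed (use h \<delta> F0 in auto)
  also have "\<dots> = 8 * \<delta> / h * circle_mean s' (\<lambda>z. \<bar>Re (F z)\<bar>)" by simp
  also have "\<dots> \<le> 8 * \<delta> / h * ((8 * \<delta> / h) ^ k * circle_mean s (\<lambda>z. \<bar>Re (F z)\<bar>))"
  proof (rule mult_left_mono)
    show "circle_mean s' (\<lambda>z. \<bar>Re (F z)\<bar>) \<le> (8 * \<delta> / h) ^ k * circle_mean s (\<lambda>z. \<bar>Re (F z)\<bar>)"
      unfolding s'_def by (rule Suc.IH) (use Suc.prems hpos in \<open>simp add: algebra_simps\<close>)
  qed (use \<delta> hpos in auto)
  finally show ?case unfolding s' by (simp add: mult_ac)
qed

text \<open>A small mean of \<open>\<bar>Re F\<bar>\<close> makes \<open>F\<close> nearly constant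
  on the circle of radius \<open>r / 2\<close>, hence \<open>p\<close> close to
  \<open>poly p 0\<close> there. A Cauchy estimate for the leading coefficient 1 limits how close,
  at a cost of at most \<open>4 ^ degree p\<close>.\<close>

lemma circle_mean_abs_Re_log_poly_ge:
  fixes p :: "complex poly"
  assumes p: "lead_coeff p = 1" "0 < degree p" and p0: "norm (poly p 0) \<le> 1"
    and F: "F holomorphic_on cball 0 r" and r: "1/2 \<le> r"
    and expF: "\<And>z. norm z \<le> r \<Longrightarrow> exp (F z) = poly p z"
    and small: "circle_mean r (\<lambda>z. \<bar>Re (F z)\<bar>) \<le> 1/4"
  shows "1 \<le> 3 * 4 ^ degree p * circle_mean r (\<lambda>z. \<bar>Re (F z)\<bar>)"
proof -
  define B where "B = circle_mean r (\<lambda>z. \<bar>Re (F z)\<bar>)"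
  define q where "q = p - [:poly p 0:]"
  have cr: "continuous_on (sphere 0 r) F"
    using F holomorphic_on_imp_continuous_on continuous_on_subset sphere_cball by blast
  have degq: "degree q = degree p" and lcq: "lead_coeff q = 1"
  proof -
    have "coeff q (degree p) = 1"
      using p by (simp add: q_def coeff_pCons split: nat.split)
    moreover have "degree q \<le> degree p"
      unfolding q_def by (rule degree_diff_le) auto
    ultimately show "degree q = degree p" "lead_coeff q = 1"
      using le_degree[of q "degree p"] by auto
  qed
  have bound: "norm (poly q z) \<le> 3 * B" if z: "norm z = r / 2" for z
  proof -
    have zr: "norm z < r" and z0: "norm (0::complex) < r" using z r by auto
    have ne: "\<zeta> \<noteq> z" "\<zeta> \<noteq> 0" if "norm \<zeta> = r" for \<zeta> using that zr z0 by auto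
    let ?H = "\<lambda>\<zeta>. of_real (2 * Re (F \<zeta>)) * (\<zeta> * (z - 0) / ((\<zeta> - z) * (\<zeta> - 0)))"
    have cH: "continuous_on (sphere 0 r) ?H"
      by (intro continuous_intros) (use cr ne in auto)
    have "norm (F z - F 0) = norm (circle_mean r ?H)"
      by (simp only: Schwarz_formula_diff[OF F z0 zr])
    also have "\<dots> \<le> circle_mean r (\<lambda>\<zeta>. norm (?H \<zeta>))"
      using r cH by (intro norm_circle_mean_le) auto
    also have "\<dots> \<le> circle_mean r (\<lambda>\<zeta>. 2 * \<bar>Re (F \<zeta>)\<bar>)"
    \<comment> \<open>At radius \<open>r / 2\<close> the point \<open>z\<close> is at least as far
      from the outer circle as from 0, so the kernel has modulus at most 2.\<close>
    proof (rule circle_mean_mono)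
      fix \<zeta> :: complex assume \<zeta>: "norm \<zeta> = r"
      have "norm z \<le> norm (\<zeta> - z)"
        using norm_triangle_ineq2[of \<zeta> z] \<zeta> z by linarith
      then have "norm z / norm (\<zeta> - z) \<le> 1" using ne[OF \<zeta>] by (simp add: divide_le_eq)
      then have "2 * \<bar>Re (F \<zeta>)\<bar> * (norm z / norm (\<zeta> - z)) \<le> 2 * \<bar>Re (F \<zeta>)\<bar> * 1"
        by (intro mult_left_mono) auto
      moreover have "norm (?H \<zeta>) = 2 * \<bar>Re (F \<zeta>)\<bar> * (norm z / norm (\<zeta> - z))"
        using ne[OF \<zeta>] by (simp add: norm_mult norm_divide)
      ultimately show "norm (?H \<zeta>) \<le> 2 * \<bar>Re (F \<zeta>)\<bar>" by simp
    qed (use r cr cH in \<open>auto intro!: continuous_intros\<close>)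
    also have "\<dots> = 2 * B" by (simp only: circle_mean_cmult B_def)
    finally have FB: "norm (F z - F 0) \<le> 2 * B" .
    have "exp (F z) = exp (F 0) * exp (F z - F 0)" by (simp flip: exp_add)
    then have "poly q z = exp (F 0) * (exp (F z - F 0) - 1)"
      using expF[of z] expF[of 0] z r by (simp add: q_def right_diff_distrib)
    also have "norm \<dots> \<le> 1 * (3 / 2 * norm (F z - F 0))"
      unfolding norm_mult
    proof (rule mult_mono)
      show "norm (exp (F 0)) \<le> 1" using expF[of 0] p0 r by auto
      \<comment> \<open>The factor \<open>3 / 2\<close> is valid for exponents of modulus at most
        \<open>1/2\<close>, which is what \<open>small\<close> ensures.\<close>
      show "norm (exp (F z - F 0) - 1) \<le> 3 / 2 * norm (F z - F 0)"
        by (rule norm_exp_bounds) (use FB small in \<open>simp add: B_def\<close>)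
    qed auto
    finally show ?thesis using FB by simp
  qed
  \<comment> \<open>The leading coefficient of \<open>q\<close> is the value at 0 of the reflected
    polynomial, and inversion carries the circle of radius \<open>r / 2\<close> to that of radius
    \<open>2 / r\<close>.\<close>
  have r2: "0 < 2 / r" using r by simp
  have hol: "poly (reflect_poly q) holomorphic_on cball 0 (2 / r)"
    by (intro holomorphic_intros)
  have cR: "continuous_on (sphere 0 (2 / r)) (poly (reflect_poly q))"
    by (intro continuous_intros)
  have "1 = norm (circle_mean (2 / r) (poly (reflect_poly q)))"
    using circle_mean_holomorphic[OF hol r2] lcq by simp
  also have "\<dots> \<le> circle_mean (2 / r) (\<lambda>w. norm (poly (reflect_poly q) w))"
    using r2 cR by (intro norm_circle_mean_le) auto
  also have "\<dots> \<le> circle_mean (2 / r) (\<lambda>w. 3 * 4 ^ degree p * B)"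
  proof (rule circle_mean_mono)
    fix w :: complex assume w: "norm w = 2 / r"
    have "w \<noteq> 0" using w r2 by auto
    then have "norm (poly (reflect_poly q) w) = (2 / r) ^ degree p * norm (poly q (inverse w))"
      by (simp add: poly_reflect_poly_nz norm_mult norm_power w degq)
    also have "\<dots> \<le> 4 ^ degree p * (3 * B)"
      using w r bound[of "inverse w"]
      by (intro mult_mono power_mono) (auto simp: norm_inverse divide_le_eq)
    finally show "norm (poly (reflect_poly q) w) \<le> 3 * 4 ^ degree p * B" by simp
  qed (use r2 cR in \<open>auto intro!: continuous_intros\<close>)
  finally show ?thesis by (simp add: B_def)
qed

subsection \<open>The potential of the zeros\<close>

text \<open>Moving from \<open>z\<close> to \<open>w\<close> changes each distance by at most
  \<open>\<delta>\<close>, and \<open>ln x \<le> x - 1\<close> bounds each logarithmic increment by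
  \<open>\<delta> / norm (z - a j)\<close>. The total at \<open>w\<close> is nonnegative.\<close>

lemma ln_norm_prod_hit:
  fixes a :: "nat \<Rightarrow> complex"
  assumes z: "\<And>j. j < n \<Longrightarrow> z \<noteq> a j" and w: "w \<in> ball z \<delta>" "1 \<le> (\<Prod>j<n. norm (w - a j))"
  shows "- (\<Sum>j<n. ln (norm (z - a j))) \<le> \<delta> * (\<Sum>j<n. 1 / norm (z - a j))"
proof -
  have pos: "0 < norm (w - a j)" if "j < n" for j
  proof -
    have "(\<Prod>j<n. norm (w - a j)) \<noteq> 0" using w(2) by linarith
    then have "norm (w - a j) \<noteq> 0" using that by (simp only: prod_zero_iff finite_lessThan) blast
    then show ?thesis by simp
  qed
  have "0 \<le> ln (\<Prod>j<n. norm (w - a j))" using w(2) by simp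
  also have "\<dots> = (\<Sum>j<n. ln (norm (w - a j)))"
    using pos by (intro ln_prod) auto
  also have "\<dots> \<le> (\<Sum>j<n. ln (norm (z - a j)) + \<delta> * (1 / norm (z - a j)))"
  proof (rule sum_mono)
    fix j assume "j \<in> {..<n}"
    then have j: "0 < norm (z - a j)" "0 < norm (w - a j)" using z pos by auto
    have "norm (w - a j) \<le> norm (w - z) + norm (z - a j)"
      using norm_triangle_ineq[of "w - z" "z - a j"] by simp
    also have "norm (w - z) \<le> \<delta>" using w(1) by (simp add: dist_norm norm_minus_commute)
    finally have "norm (w - a j) / norm (z - a j) \<le> (\<delta> + norm (z - a j)) / norm (z - a j)"
      using j by (intro divide_right_mono) auto
    also have "\<dots> = 1 + \<delta> * (1 / norm (z - a j))" using j by (simp add: field_simps)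
    finally have "norm (w - a j) / norm (z - a j) - 1 \<le> \<delta> * (1 / norm (z - a j))" by simp
    moreover have "ln (norm (w - a j) / norm (z - a j)) \<le> norm (w - a j) / norm (z - a j) - 1"
      using j by (intro ln_le_minus_one) auto
    ultimately show "ln (norm (w - a j)) \<le> ln (norm (z - a j)) + \<delta> * (1 / norm (z - a j))"
      using j by (simp add: ln_div)
  qed
  also have "\<dots> = (\<Sum>j<n. ln (norm (z - a j))) + \<delta> * (\<Sum>j<n. 1 / norm (z - a j))"
    by (simp add: sum.distrib sum_distrib_left)
  finally show ?thesis by simp
qed

text \<open>The negative part of \<open>u\<close> is at most \<open>g\<close>, whose mean is at most
  \<open>16 * n * \<delta>\<close>, that is \<open>1 / 160\<close>. Jensen's formula gives
  \<open>u\<close> a mean of at most 0, so the mean of its absolute value is at most twice that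
  bound.\<close>

lemma exists_circle_log_small:
  fixes a :: "nat \<Rightarrow> complex"
  assumes n: "0 < n" and a: "\<And>j. j < n \<Longrightarrow> norm (a j) \<le> 1" and \<delta>: "0 < \<delta>" "real n * \<delta> \<le> 1 / 2560"
    and hit: "\<And>z. \<exists>w\<in>ball z \<delta>. 1 \<le> (\<Prod>j<n. norm (w - a j))"
  obtains s where "7/10 < s" "s < 9/10" "\<And>j. j < n \<Longrightarrow> s < norm (a j)"
    "circle_mean s (\<lambda>z. \<bar>\<Sum>j<n. ln (norm (z - a j))\<bar>) \<le> 1 / 80"
proof -
  obtain x where x: "1/2 < x" "x < 3/4" "\<And>j. j < n \<Longrightarrow> (norm (a j))\<^sup>2 \<noteq> x"
    "(\<Sum>j<n. 1 / sqrt \<bar>x - (norm (a j))\<^sup>2\<bar>) \<le> 16 * real n"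
    by (rule exists_sum_inverse_sqrt_le[of n "\<lambda>j. (norm (a j))\<^sup>2"]) (use n a in \<open>auto simp: power_le_one\<close>)
  \<comment> \<open>Squared radii enter because the mean of \<open>1 / norm (z - a j)\<close> is
    bounded through \<open>s\<^sup>2 - (norm (a j))\<^sup>2\<close>.\<close>
  define s where "s = sqrt x"
  have s2: "s\<^sup>2 = x" using x by (simp add: s_def)
  have "7/10 < s" unfolding s_def by (rule real_less_rsqrt) (use x in \<open>simp add: power2_eq_square\<close>)
  moreover have "s < 9/10" unfolding s_def by (rule real_less_lsqrt) (use x in \<open>simp_all add: power2_eq_square\<close>)
  ultimately have s: "7/10 < s" "s < 9/10" "0 < s" by auto
  have as: "norm (a j) \<noteq> s" if "j < n" for j using x(3)[OF that] s2 by auto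
  have ne: "z \<noteq> a j" if "norm z = s" "j < n" for z j using as that by auto
  define u where "u = (\<lambda>z. \<Sum>j<n. ln (norm (z - a j)))"
  define g where "g = (\<lambda>z. \<delta> * (\<Sum>j<n. 1 / norm (z - a j)))"
  have cl: "continuous_on (sphere 0 s) (\<lambda>z. ln (norm (z - a j)))"
    and ci: "continuous_on (sphere 0 s) (\<lambda>z. 1 / norm (z - a j))" if "j < n" for j
    using ne[OF _ that] by (auto intro!: continuous_intros)
  have cu: "continuous_on (sphere 0 s) u" unfolding u_def using cl by (intro continuous_on_sum) auto
  have cg: "continuous_on (sphere 0 s) g" unfolding g_def using ci by (intro continuous_on_mult continuous_on_const continuous_on_sum) auto
  have "circle_mean s g = \<delta> * (\<Sum>j<n. circle_mean s (\<lambda>z. 1 / norm (z - a j)))"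
    unfolding g_def circle_mean_cmult using s ci by (subst circle_mean_sum) auto
  also have "(\<Sum>j<n. circle_mean s (\<lambda>z. 1 / norm (z - a j))) \<le> (\<Sum>j<n. 1 / sqrt \<bar>x - (norm (a j))\<^sup>2\<bar>)"
  proof (rule sum_mono)
    fix j assume "j \<in> {..<n}"
    then have "norm (a j) \<noteq> s" using as by simp
    from circle_mean_inverse_le[OF s(3) this]
    show "circle_mean s (\<lambda>z. 1 / norm (z - a j)) \<le> 1 / sqrt \<bar>x - (norm (a j))\<^sup>2\<bar>"
      by (simp only: s2)
  qed
  also have "\<dots> \<le> 16 * real n" by (rule x)
  finally have "circle_mean s g \<le> \<delta> * (16 * real n)" using \<delta> by simp
  then have gs: "circle_mean s g \<le> 1 / 160" using \<delta> by (simp add: mult_ac)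
  have ug: "- u z \<le> g z" if "norm z = s" for z
  proof -
    obtain w where "w \<in> ball z \<delta>" "1 \<le> (\<Prod>j<n. norm (w - a j))" using hit by blast
    then show ?thesis unfolding u_def g_def using ne[OF that] by (intro ln_norm_prod_hit) auto
  qed
  have g0: "0 \<le> g z" for z unfolding g_def using \<delta> by (intro mult_nonneg_nonneg sum_nonneg) auto
  have um: "circle_mean s u = (\<Sum>j<n. ln (max s (norm (a j))))"
  proof -
    have "circle_mean s u = (\<Sum>j<n. circle_mean s (\<lambda>z. ln (norm (z - a j))))"
      unfolding u_def using s(3) cl by (intro circle_mean_sum) auto
    then show ?thesis
      using circle_mean_ln_norm[OF s(3) as] by simp
  qed
  have lnle: "ln (max s (norm (a j))) \<le> 0" if "j < n" for j
    using a[OF that] s by simp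
  have "circle_mean s (\<lambda>z. \<bar>u z\<bar>) \<le> circle_mean s (\<lambda>z. u z + 2 * g z)"
  proof (rule circle_mean_mono)
    show "\<bar>u z\<bar> \<le> u z + 2 * g z" if "norm z = s" for z using ug[OF that] g0[of z] by linarith
  qed (use s cu cg in \<open>auto intro!: continuous_intros\<close>)
  also have "\<dots> = circle_mean s u + 2 * circle_mean s g"
    using s cu cg by (subst circle_mean_add) (auto intro!: continuous_intros simp: circle_mean_cmult)
  finally have abs: "circle_mean s (\<lambda>z. \<bar>u z\<bar>) \<le> circle_mean s u + 1 / 80" using gs by simp
  have u0: "circle_mean s u \<le> 0" unfolding um using lnle by (intro sum_nonpos) auto
  have lower: "- (1 / 160) \<le> circle_mean s u"
  proof -
    have "circle_mean s (\<lambda>z. - g z) \<le> circle_mean s u"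
      by (rule circle_mean_mono) (use s cu cg ug in \<open>auto intro!: continuous_intros simp: minus_le_iff\<close>)
    then show ?thesis using gs circle_mean_cmult[of s "-1" g] by simp
  qed
  \<comment> \<open>By Jensen's formula one zero within radius \<open>s\<close> would pull the mean
    of \<open>u\<close> down to at most \<open>ln s\<close>, which is below \<open>- 1 / 10\<close>
    and so contradicts \<open>lower\<close>.\<close>
  have big: "s < norm (a j)" if j: "j < n" for j
  proof (rule ccontr)
    assume "\<not> ?thesis"
    then have "ln (max s (norm (a j))) = ln s" by (simp add: max_def)
    moreover have "circle_mean s u \<le> ln (max s (norm (a j)))"
    proof -
      have "circle_mean s u = ln (max s (norm (a j))) + (\<Sum>i\<in>{..<n} - {j}. ln (max s (norm (a i))))"
        unfolding um using j by (subst sum.remove[of _ j]) auto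
      moreover have "(\<Sum>i\<in>{..<n} - {j}. ln (max s (norm (a i)))) \<le> 0"
        using lnle by (intro sum_nonpos) auto
      ultimately show ?thesis by linarith
    qed
    moreover have "ln s \<le> s - 1" using s by (intro ln_le_minus_one) auto
    ultimately show False using lower s by linarith
  qed
  show thesis
    by (rule that[of s]) (use s big abs u0 in \<open>auto simp: u_def\<close>)
qed

text \<open>The decay \<open>1 / 64\<close> per step, over \<open>n\<close> steps, beats the loss
  \<open>4 ^ n\<close> in recovering the leading coefficient.\<close>

lemma no_disc_impossible:
  fixes p :: "complex poly"
  assumes p: "p \<in> disc_polys n" and n: "0 < n"
    and hit: "\<And>z. \<exists>w\<in>ball z (1 / (2560 * real n)). 1 \<le> norm (poly p w)"
  shows False
proof -
  define \<delta> where "\<delta> = 1 / (2560 * real n)"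
  have \<delta>: "0 < \<delta>" "real n * \<delta> \<le> 1 / 2560" using n by (auto simp: \<delta>_def)
  have lc: "lead_coeff p = 1" and deg: "degree p = n" and roots: "\<And>z. poly p z = 0 \<Longrightarrow> norm z \<le> 1"
    using p by (auto simp: disc_polys_def)
  obtain a where a: "p = (\<Prod>j<n. [:- a j, 1:])"
    using complex_poly_decompose'[of p] lc deg by (metis smult_1_left)
  have pz: "poly p z = (\<Prod>j<n. z - a j)" for z
    unfolding a poly_prod by simp
  have npz: "norm (poly p z) = (\<Prod>j<n. norm (z - a j))" for z
    by (simp add: pz prod_norm)
  have a1: "norm (a j) \<le> 1" if "j < n" for j
    by (rule roots) (use that in \<open>auto simp: pz\<close>)
  obtain s where s: "7/10 < s" "s < 9/10" "\<And>j. j < n \<Longrightarrow> s < norm (a j)"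
    "circle_mean s (\<lambda>z. \<bar>\<Sum>j<n. ln (norm (z - a j))\<bar>) \<le> 1 / 80"
    by (rule exists_circle_log_small[OF n a1 \<delta>]) (use hit in \<open>auto simp: npz \<delta>_def\<close>)
  \<comment> \<open>A holomorphic logarithm of \<open>p\<close> on the closed disc of radius
    \<open>s\<close>: all zeros lie outside it, so each \<open>1 - z / a j\<close> has positive real
    part.\<close>
  define F where "F = (\<lambda>z. (\<Sum>j<n. Ln (1 - z / a j)) + Ln (poly p 0))"
  have a0: "a j \<noteq> 0" if "j < n" for j using s(3)[OF that] s(1) by auto
  have p0: "poly p 0 \<noteq> 0" using a0 by (simp add: pz)
  have nonpos: "1 - z / a j \<notin> \<real>\<^sub>\<le>\<^sub>0" if "norm z \<le> s" "j < n" for z j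
  proof -
    have "norm (z / a j) < 1" using that s(3)[of j] a0[of j] by (simp add: norm_divide)
    from Re_one_minus_pos[OF this] show ?thesis by (auto simp: complex_nonpos_Reals_iff)
  qed
  have F: "F holomorphic_on cball 0 s"
    unfolding F_def using nonpos a0 by (intro holomorphic_intros) auto
  have expF: "exp (F z) = poly p z" if z: "norm z \<le> s" for z
  proof -
    have "exp (F z) = (\<Prod>j<n. exp (Ln (1 - z / a j))) * poly p 0"
      using p0 by (simp add: F_def exp_add exp_sum)
    also have "(\<Prod>j<n. exp (Ln (1 - z / a j))) = (\<Prod>j<n. 1 - z / a j)"
    proof (rule prod.cong)
      fix j assume "j \<in> {..<n}"
      then have "1 - z / a j \<noteq> 0" using nonpos[OF z, of j] by auto
      then show "exp (Ln (1 - z / a j)) = 1 - z / a j" by simp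
    qed simp
    also have "\<dots> * poly p 0 = (\<Prod>j<n. (1 - z / a j) * (0 - a j))"
      by (simp only: pz prod.distrib)
    also have "\<dots> = (\<Prod>j<n. z - a j)"
      using a0 by (intro prod.cong) (auto simp: field_simps)
    finally show ?thesis by (simp add: pz)
  qed
  have eReF: "exp (Re (F z)) = norm (poly p z)" if "norm z \<le> s" for z
    using expF[OF that] by (metis norm_exp_eq_Re)
  have ReF: "Re (F z) = (\<Sum>j<n. ln (norm (z - a j)))" if "norm z \<le> s" for z
  proof -
    have "Re (F z) = ln (norm (poly p z))" using eReF[OF that] by (metis ln_exp)
    also have "\<dots> = (\<Sum>j<n. ln (norm (z - a j)))"
      unfolding npz using s(3) that by (intro ln_prod) force+
    finally show ?thesis .
  qed
  have p01: "norm (poly p 0) \<le> 1"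
    unfolding npz using a1 by (intro prod_le_1) auto
  have "exp (Re (F 0)) \<le> 1" using eReF[of 0] p01 s(1) by simp
  then have ReF0: "Re (F 0) \<le> 0" by simp
  have Bs: "circle_mean s (\<lambda>z. \<bar>Re (F z)\<bar>) \<le> 1 / 80"
  proof -
    have "circle_mean s (\<lambda>z. \<bar>Re (F z)\<bar>) = circle_mean s (\<lambda>z. \<bar>\<Sum>j<n. ln (norm (z - a j))\<bar>)"
      by (rule circle_mean_cong) (use s ReF in auto)
    then show ?thesis using s(4) by simp
  qed
  \<comment> \<open>The \<open>n\<close> steps consume \<open>1/5\<close> in total, so starting
    above \<open>7/10\<close> the final radius is at least \<open>1/2\<close>, while
    \<open>8 * \<delta> / h\<close> is still as small as \<open>1 / 64\<close>.\<close>
  define h where "h = 1 / (5 * real n)"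
  have nh: "real n * h = 1 / 5" using n by (simp add: h_def)
  have q: "8 * \<delta> / h = 1 / 64" using n by (simp add: h_def \<delta>_def)
  have \<delta>h: "2 * \<delta> \<le> h" using n by (simp add: h_def \<delta>_def field_simps)
  define r where "r = s - real n * h"
  have r: "1/2 \<le> r" "r \<le> s" using s nh by (auto simp: r_def)
  have "circle_mean r (\<lambda>z. \<bar>Re (F z)\<bar>) \<le> (8 * \<delta> / h) ^ n * circle_mean s (\<lambda>z. \<bar>Re (F z)\<bar>)"
    unfolding r_def
  proof (rule circle_mean_abs_Re_decay[OF F \<delta>h \<delta>(1) ReF0])
    show "\<exists>w\<in>ball z \<delta>. 0 \<le> Re (F w)" if z: "norm z \<le> s - h" for z
    proof -
      obtain w where w: "w \<in> ball z \<delta>" "1 \<le> norm (poly p w)" using hit \<delta>_def by blast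
      \<comment> \<open>The nearby point stays where \<open>F\<close> is a logarithm of
        \<open>p\<close>, because \<open>\<delta>\<close> is smaller than the margin
        \<open>h\<close>.\<close>
      have "norm w \<le> s"
        using norm_triangle_sub[of w z] w(1) z \<delta>h \<delta>(1) by (simp add: dist_norm norm_minus_commute)
      then have "0 \<le> Re (F w)" using eReF[of w] w(2) by (simp flip: one_le_exp_iff)
      then show ?thesis using w(1) by blast
    qed
  qed (use nh s in auto)
  also have "\<dots> \<le> (1 / 64) ^ n * (1 / 80)"
    unfolding q using Bs by (intro mult_left_mono) auto
  finally have Br: "circle_mean r (\<lambda>z. \<bar>Re (F z)\<bar>) \<le> (1 / 64) ^ n * (1 / 80)" .
  have "(1 / 64) ^ n \<le> (1::real)" by (simp add: power_le_one)
  have "1 \<le> 3 * 4 ^ degree p * circle_mean r (\<lambda>z. \<bar>Re (F z)\<bar>)"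
  proof (rule circle_mean_abs_Re_log_poly_ge[OF lc _ p01 holomorphic_on_subset[OF F] r(1)])
    show "circle_mean r (\<lambda>z. \<bar>Re (F z)\<bar>) \<le> 1 / 4" using Br \<open>(1 / 64) ^ n \<le> (1::real)\<close> by linarith
  qed (use n deg r expF in auto)
  also have "\<dots> \<le> 3 * 4 ^ n * ((1 / 64) ^ n * (1 / 80))"
    unfolding deg using Br by (intro mult_left_mono) auto
  also have "\<dots> = 3 / 80 * (4 * (1 / 64)) ^ n" by (simp only: power_mult_distrib mult_ac)
  also have "\<dots> \<le> 3 / 80 * 1" by (intro mult_left_mono power_le_one) auto
  finally show False by simp
qed

lemma min_inradius_ge:
  assumes "0 < n"
  shows "ennreal (1 / (2560 * real n)) \<le> min_inradius n"
  unfolding min_inradius_def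
proof (rule INF_greatest)
  fix p assume "p \<in> disc_polys n"
  then obtain z where z: "\<And>w. w \<in> ball z (1 / (2560 * real n)) \<Longrightarrow> norm (poly p w) < 1"
    using no_disc_impossible[of p n] assms by (meson not_le)
  then have "ball z (1 / (2560 * real n)) \<subseteq> lemniscate p"
    by (auto simp: lemniscate_def)
  then have "1 / (2560 * real n) \<in> {r. 0 < r \<and> (\<exists>z. ball z r \<subseteq> lemniscate p)}"
    using assms by auto
  then show "ennreal (1 / (2560 * real n)) \<le> inradius (lemniscate p)"
    unfolding inradius_def by (rule SUP_upper)
qed

theorem theorem8:
  shows "\<exists>c::real. 0 < c \<and>
    (\<forall>n::nat. 2 \<le> n \<longrightarrow> ennreal (c / (real n * sqrt (ln (real n)))) \<le> min_inradius n)"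
proof (intro exI conjI allI impI)
  \<comment> \<open>The bound \<open>1 / (2560 * n)\<close> carries no logarithm; since
    \<open>ln n \<ge> ln 2\<close>, the factor \<open>sqrt (ln 2)\<close> in the constant absorbs
    the one in the statement.\<close>
  show "0 < sqrt (ln 2) / 2560" by simp
  fix n :: nat assume n: "2 \<le> n"
  have "sqrt (ln 2) \<le> sqrt (ln (real n))" using n by simp
  moreover have "0 < sqrt (ln (real n))" using n by simp
  ultimately have "sqrt (ln 2) / 2560 / (real n * sqrt (ln (real n))) \<le> 1 / (2560 * real n)"
    using n by (simp add: field_simps)
  then show "ennreal (sqrt (ln 2) / 2560 / (real n * sqrt (ln (real n)))) \<le> min_inradius n"
    using order_trans[OF ennreal_leI min_inradius_ge] n by simp
qed

end
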